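(* Let $n\in\mathbb{N}$, $n\geq 1$, and let $T_n$ be the rooted tree of height one with $n$ leaves (a root $\lambda$ with exactly $n$ children, all of them leaves). Then the lattice $\mathrm{Id}(\mathbf{A}^{T_n})$ of ideals of the commutative BCK-algebra $\mathbf{A}^{T_n}$, ordered by inclusion, is isomorphic as a lattice to $\overline{\mathbb{B}}_n$.
   Context: $\overline{\mathbb{B}}_n=\mathbb{B}_n\oplus\mathbf{1}$ is the lattice obtained from the powerset lattice $\mathbb{B}_n$ of $\{1,\dots,n\}$ by adjoining a new top element strictly above all elements of $\mathbb{B}_n$. A commutative BCK-algebra is an algebra $\mathbf{A}=\langle A;\cdot,0\rangle$ of type $(2,0)$ such that for all $x,y,z\in A$: $(x\cdot y)\cdot z=(x\cdot z)\cdot y$; $x\cdot(x\cdot y)=y\cdot(y\cdot x)$; $x\cdot x=0$; $x\cdot 0=x$. An ideal is a subset $I\subseteq A$ with $0\in I$ such that $x\cdot y\in I$ and $y\in I$ imply $x\in I$. Let $T$ be a rooted tree with root $\lambda$ and vertex set $V(T)$. A root-based path is a path in $T$ starting at $\lambda$ and moving away from the root (it contains at least $\lambda$); $[\lambda,\alpha]$ is the path from $\lambda$ to $\alpha$. For $\mathbf{u}\colon V(T)\to\mathbb{Z}$ write $u_\alpha$ for its value at $\alpha$ and $\mathbf{u}_p$ for the tuple of values of $\mathbf{u}$ along the path $p$; $\mathbf{0}$ is the zero function. The set $A^T$ consists of all $\mathbf{u}\colon V(T)\to\mathbb{Z}$ with finitely many non-zero values such that along every root-based path the first non-zero value (if any)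 is positive. With $\le_\ell$ the lexicographic order on tuples, define $$(\mathbf{u}\cdot\mathbf{v})_\alpha=\begin{cases}u_\alpha-v_\alpha&\text{if }\mathbf{u}_{[\lambda,\alpha]}>_\ell\mathbf{v}_{[\lambda,\alpha]},\\0&\text{if }\mathbf{u}_{[\lambda,\alpha]}\le_\ell\mathbf{v}_{[\lambda,\alpha]}.\end{cases}$$ Then $\mathbf{A}^T=\langle A^T;\cdot,\mathbf{0}\rangle$ is a commutative BCK-algebra. *)

theory Defs
  imports
    "HOL-Algebra.Lattice"
    "HOL-Library.FuncSet"
    "HOL-Library.Lattice_Constructions"
    "Graph_Theory.Graph_Theory"
begin

section \<open>Commutative BCK-algebras and their ideals\<close>

record 'a bck = "'a partial_object" +
  bck_op :: "['a, 'a] \<Rightarrow> 'a" (infixl \<open>\<cdot>\<index>\<close> 70)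
  bck_zero :: 'a (\<open>\<zero>\<index>\<close>)

locale comm_bck_algebra =
  fixes A (structure)
  assumes op_closed: "\<lbrakk>x \<in> carrier A; y \<in> carrier A\<rbrakk> \<Longrightarrow> x \<cdot> y \<in> carrier A"
    and zero_closed: "\<zero> \<in> carrier A"
    and op_right_commute:
      "\<lbrakk>x \<in> carrier A; y \<in> carrier A; z \<in> carrier A\<rbrakk> \<Longrightarrow> (x \<cdot> y) \<cdot> z = (x \<cdot> z) \<cdot> y"
    and meet_commute: "\<lbrakk>x \<in> carrier A; y \<in> carrier A\<rbrakk> \<Longrightarrow> x \<cdot> (x \<cdot> y) = y \<cdot> (y \<cdot> x)"
    and op_self: "x \<in> carrier A \<Longrightarrow> x \<cdot> x = \<zero>"
    and op_zero: "x \<in> carrier A \<Longrightarrow> x \<cdot> \<zero> = x"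

definition bck_ideal :: "('a, 'b) bck_scheme \<Rightarrow> 'a set \<Rightarrow> bool" where
  "bck_ideal A I \<longleftrightarrow> I \<subseteq> carrier A \<and> \<zero>\<^bsub>A\<^esub> \<in> I \<and>
     (\<forall>x \<in> carrier A. \<forall>y \<in> carrier A. x \<cdot>\<^bsub>A\<^esub> y \<in> I \<and> y \<in> I \<longrightarrow> x \<in> I)"

definition ideal_lattice :: "('a, 'b) bck_scheme \<Rightarrow> 'a set gorder" where
  "ideal_lattice A = \<lparr>carrier = {I. bck_ideal A I}, eq = (=), le = (\<subseteq>)\<rparr>"


section \<open>The algebra of a rooted tree\<close>

text \<open>
  A rooted tree is given by its arcs, directed away from the root.  Uniqueness is required of
  walks, not only of paths: this also rules out arcs leading back to an ancestor.  The tree may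
  be infinite.
\<close>

locale rooted_tree = pair_wf_digraph T for T :: "'v pair_pre_digraph" +
  fixes r :: 'v
  assumes unique_walk: "v \<in> pverts T \<Longrightarrow> \<exists>!p. vwalk p (with_proj T) \<and> hd p = r \<and> last p = v"
    and root_in_verts: "r \<in> pverts T"

definition root_path :: "'v pair_pre_digraph \<Rightarrow> 'v \<Rightarrow> 'v list \<Rightarrow> bool" where
  "root_path T r p \<longleftrightarrow> vpath p (with_proj T) \<and> hd p = r"

definition path_to :: "'v pair_pre_digraph \<Rightarrow> 'v \<Rightarrow> 'v \<Rightarrow> 'v list" where
  "path_to T r \<alpha> = (THE p. root_path T r p \<and> last p = \<alpha>)"

definition tree_carrier :: "'v pair_pre_digraph \<Rightarrow> 'v \<Rightarrow> ('v \<Rightarrow> int) set" where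
  "tree_carrier T r = {u \<in> pverts T \<rightarrow>\<^sub>E UNIV.
     finite {\<alpha> \<in> pverts T. u \<alpha> \<noteq> 0} \<and>
     (\<forall>p. root_path T r p \<longrightarrow>
        (\<forall>i < length p. u (p ! i) \<noteq> 0 \<and> (\<forall>j < i. u (p ! j) = 0) \<longrightarrow> u (p ! i) > 0))}"

text \<open>
  The two tuples compared have the same length, so \<open>ord_class.lexordp\<close> is the strict lexicographic order on
  them, and, this order being total, the second case is its negation.
\<close>

definition tree_op :: "'v pair_pre_digraph \<Rightarrow> 'v \<Rightarrow> ('v \<Rightarrow> int) \<Rightarrow> ('v \<Rightarrow> int) \<Rightarrow> 'v \<Rightarrow> int" where
  "tree_op T r u v = (\<lambda>\<alpha> \<in> pverts T.
     if ord_class.lexordp (map v (path_to T r \<alpha>)) (map u (path_to T r \<alpha>)) then u \<alpha> - v \<alpha> else 0)"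

definition tree_algebra :: "'v pair_pre_digraph \<Rightarrow> 'v \<Rightarrow> ('v \<Rightarrow> int) bck" where
  "tree_algebra T r =
     \<lparr>carrier = tree_carrier T r, bck_op = tree_op T r, bck_zero = (\<lambda>\<alpha> \<in> pverts T. 0)\<rparr>"

definition star_tree :: "nat \<Rightarrow> nat pair_pre_digraph" where
  "star_tree n = \<lparr>pverts = {0..n}, parcs = {0} \<times> {1..n}\<rparr>"


section \<open>Lattices\<close>

definition boolean_lattice_with_top :: "nat \<Rightarrow> nat set top gorder" where
  "boolean_lattice_with_top n =
     \<lparr>carrier = insert top.Top (top.Value ` Pow {1..n}), eq = (=), le = (\<le>)\<rparr>"

text \<open>\<open>join_pres\<close> and \<open>meet_pres\<close> include that both structures are lattices.\<close>

definition lattice_isomorphic :: "('a, 'c) gorder_scheme \<Rightarrow> ('b, 'd) gorder_scheme \<Rightarrow> bool" where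
  "lattice_isomorphic X Y \<longleftrightarrow>
     (\<exists>f. bij_betw f (carrier X) (carrier Y) \<and> join_pres X Y f \<and> meet_pres X Y f)"


section \<open>The definitions describe the intended structures\<close>

lemma vwalk_snoc:
  assumes "p \<noteq> []"
  shows "vwalk (p @ [x]) (with_proj T) \<longleftrightarrow>
    vwalk p (with_proj T) \<and> x \<in> pverts T \<and> (last p, x) \<in> parcs T"
  using assms
proof (induction p rule: vwalk_arcs.induct)
  case (3 a b xs)
  then show ?case by (auto simp: vwalk_def)
qed (auto simp: vwalk_def)

lemma star_tree_vwalk:
  assumes "vwalk p (with_proj (star_tree n))" "hd p = 0"
  shows "p = (if last p = 0 then [0] else [0, last p])"
proof (cases p rule: vwalk_arcs.cases)
  case (3 a b xs)
  then have "(a, b) \<in> parcs (star_tree n)" using assms by (auto simp: vwalk_def)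
  moreover have "xs = []"
    using assms 3 calculation by (cases xs) (auto simp: vwalk_def star_tree_def)
  ultimately show ?thesis using 3 by (auto simp: star_tree_def)
qed (use assms in \<open>auto simp: vwalk_def\<close>)

lemma rooted_tree_star_tree: "rooted_tree (star_tree n) 0"
proof
  fix v assume v: "v \<in> pverts (star_tree n)"
  show "\<exists>!p. vwalk p (with_proj (star_tree n)) \<and> hd p = 0 \<and> last p = v"
  proof (rule ex1I)
    show "vwalk (if v = 0 then [0] else [0, v]) (with_proj (star_tree n)) \<and>
      hd (if v = 0 then [0] else [0, v]) = 0 \<and> last (if v = 0 then [0] else [0, v]) = v"
      using v by (auto simp: vwalk_def star_tree_def)
  qed (use star_tree_vwalk in metis)
qed (auto simp: star_tree_def)

context rooted_tree
begin

lemma walk_distinct: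
  assumes "vwalk p (with_proj T)" "hd p = r"
  shows "distinct p"
  using assms
proof (induction p rule: rev_induct)
  case (snoc x p)
  show ?case
  proof (cases "p = []")
    case False
    then have p: "vwalk p (with_proj T)" "hd p = r"
      using snoc.prems vwalk_snoc[OF False] by auto
    have "x \<notin> set p"
    proof
      assume "x \<in> set p"
      then obtain ys zs where s: "p = (ys @ [x]) @ zs" by (metis append.assoc append_Cons append_Nil split_list)
      have pre: "vwalk (ys @ [x]) (with_proj T)"
        using p(1) unfolding s
      proof (induction zs rule: rev_induct)
        case (snoc z zs)
        have "vwalk (((ys @ [x]) @ zs) @ [z]) (with_proj T)"
          using snoc.prems by simp
        then have "vwalk ((ys @ [x]) @ zs) (with_proj T)"
          using vwalk_snoc[of "(ys @ [x]) @ zs" z T] by fastforce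
        then show ?case by (rule snoc.IH)
      qed simp
      have h: "hd (ys @ [x]) = r" using p(2) s by (cases ys) auto
      have "x \<in> pverts T" using pre by (auto simp: vwalk_def)
      from unique_walk[OF this] have "ys @ [x] = p @ [x]"
        using pre h snoc.prems by (metis last_snoc)
      then show False using s by simp
    qed
    then show ?thesis using snoc.IH[OF p] by simp
  qed simp
qed simp

lemma root_path_iff: "root_path T r p \<longleftrightarrow> vwalk p (with_proj T) \<and> hd p = r"
  using walk_distinct by (auto simp: root_path_def vpath_def)

lemma path_to_eqI: "root_path T r p \<Longrightarrow> path_to T r (last p) = p"
  unfolding path_to_def root_path_iff
  using unique_walk[of "last p"] by (intro the_equality) (auto simp: vwalk_def subset_iff)

lemma path_to:
  assumes "\<alpha> \<in> pverts T"
  shows "root_path T r (path_to T r \<alpha>)" "last (path_to T r \<alpha>) = \<alpha>"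
  using unique_walk[OF assms] path_to_eqI unfolding root_path_iff by metis+

lemma root_path_take:
  assumes "root_path T r p" "i < length p"
  shows "root_path T r (take (Suc i) p)"
proof -
  have "root_path T r (take (Suc i) p)" if "root_path T r p" "i < length p" for p
    using that
  proof (induction p rule: rev_induct)
    case (snoc x p)
    show ?case
    proof (cases "i < length p")
      case True
      then have "p \<noteq> []" by auto
      then have "root_path T r p"
        using snoc.prems vwalk_snoc[of p x T] by (auto simp: root_path_iff)
      then show ?thesis using snoc.IH True by simp
    qed (use snoc.prems in simp)
  qed simp
  then show ?thesis using assms by blast
qed

lemma path_to_nth:
  assumes "root_path T r p" "i < length p"
  shows "path_to T r (p ! i) = take (Suc i) p"
  using path_to_eqI[OF root_path_take[OF assms]] assms(2)
  by (simp add: take_Suc_conv_app_nth)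

lemma root_path_verts: "root_path T r p \<Longrightarrow> i < length p \<Longrightarrow> p ! i \<in> pverts T"
  by (auto simp: root_path_iff vwalk_def)

end

definition lead_pos :: "'v list \<Rightarrow> ('v \<Rightarrow> int) \<Rightarrow> bool" where
  "lead_pos p w \<longleftrightarrow> (\<exists>k < length p. w (p ! k) > 0 \<and> (\<forall>j < k. w (p ! j) = 0))"

lemma lexordp_lead_pos:
  fixes u v :: "'v \<Rightarrow> int"
  shows "ord_class.lexordp (map v p) (map u p) \<longleftrightarrow> lead_pos p (\<lambda>a. u a - v a)"
  by (induction p) (auto simp: lead_pos_def Ex_less_Suc2 All_less_Suc2)

lemma lead_pos_cong:
  "(\<And>a. a \<in> set p \<Longrightarrow> w a = w' a) \<Longrightarrow> lead_pos p w \<longleftrightarrow> lead_pos p w'"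
  unfolding lead_pos_def by (metis nth_mem order.strict_trans)

lemma lead_pos_zero: "(\<And>a. a \<in> set p \<Longrightarrow> w a = 0) \<Longrightarrow> \<not> lead_pos p w"
  unfolding lead_pos_def by (metis nth_mem less_irrefl)

lemma lead_pos_asym: "lead_pos p w \<Longrightarrow> \<not> lead_pos p (\<lambda>a. - w a)"
  unfolding lead_pos_def by (metis linorder_neqE_nat neg_0_less_iff_less not_less_iff_gr_or_eq neg_equal_0_iff_equal)

lemma lead_pos_cases:
  assumes "\<not> lead_pos p w" "\<not> lead_pos p (\<lambda>a. - w a)" "a \<in> set p"
  shows "w a = 0"
proof (rule ccontr)
  assume "w a \<noteq> 0"
  then have ex: "\<exists>k. k < length p \<and> w (p ! k) \<noteq> 0" using assms(3) by (metis in_set_conv_nth)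
  define k where "k = (LEAST k. k < length p \<and> w (p ! k) \<noteq> 0)"
  have k: "k < length p" "w (p ! k) \<noteq> 0" using LeastI_ex[OF ex] by (auto simp: k_def)
  have "w (p ! j) = 0" if "j < k" for j
    using not_less_Least[of j "\<lambda>k. k < length p \<and> w (p ! k) \<noteq> 0"] that k(1) by (auto simp: k_def)
  then show False using k assms(1,2) unfolding lead_pos_def
    by (metis linorder_neqE_linordered_idom neg_0_less_iff_less neg_equal_0_iff_equal)
qed

lemma lead_pos_add:
  assumes "lead_pos p v" "lead_pos p w"
  shows "lead_pos p (\<lambda>a. v a + w a)"
proof -
  obtain i where i: "i < length p" "v (p ! i) > 0" "\<And>j. j < i \<Longrightarrow> v (p ! j) = 0"
    using assms(1) by (auto simp: lead_pos_def)
  obtain j where j: "j < length p" "w (p ! j) > 0" "\<And>k. k < j \<Longrightarrow> w (p ! k) = 0"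
    using assms(2) by (auto simp: lead_pos_def)
  show ?thesis unfolding lead_pos_def
    by (rule exI[of _ "min i j"], cases i j rule: linorder_cases) (use i j in auto)
qed

lemma lead_pos_add_nonneg:
  assumes "lead_pos p v" "\<not> lead_pos p (\<lambda>a. - w a)"
  shows "lead_pos p (\<lambda>a. v a + w a)"
proof (cases "lead_pos p w")
  case False
  then have "w a = 0" if "a \<in> set p" for a using lead_pos_cases assms(2) that by metis
  then show ?thesis using assms(1) lead_pos_cong[of p v "\<lambda>a. v a + w a"] by simp
qed (use assms(1) lead_pos_add in metis)

lemma tree_carrier_iff:
  "u \<in> tree_carrier T r \<longleftrightarrow> u \<in> pverts T \<rightarrow>\<^sub>E UNIV \<and> finite {\<alpha> \<in> pverts T. u \<alpha> \<noteq> 0} \<and>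
     (\<forall>p. root_path T r p \<longrightarrow> \<not> lead_pos p (\<lambda>a. - u a))"
  unfolding tree_carrier_def lead_pos_def
  by (simp, metis linorder_neqE_linordered_idom less_irrefl order_less_asym)

context rooted_tree
begin

lemma tree_op_path:
  assumes p: "root_path T r p" and a: "a \<in> set p"
  shows "tree_op T r u v a = (if lead_pos p (\<lambda>a. u a - v a) then u a - v a else 0)"
proof -
  obtain i where i: "i < length p" "a = p ! i" using a by (metis in_set_conv_nth)
  let ?w = "\<lambda>a. u a - v a"
  have "lead_pos p ?w" if "lead_pos (take (Suc i) p) ?w"
    using that unfolding lead_pos_def by force
  moreover have "?w a = 0" if l: "lead_pos p ?w" and n: "\<not> lead_pos (take (Suc i) p) ?w"
  proof -
    obtain k where k: "k < length p" "?w (p ! k) > 0" "\<forall>j<k. ?w (p ! j) = 0"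
      using l by (auto simp: lead_pos_def)
    have "\<not> k \<le> i"
    proof
      assume "k \<le> i"
      then have "lead_pos (take (Suc i) p) ?w"
        unfolding lead_pos_def using k by (intro exI[of _ k]) auto
      then show False using n by simp
    qed
    then show ?thesis using k(3) i by simp
  qed
  ultimately show ?thesis
    using root_path_verts[OF p i(1)] i
    by (auto simp: tree_op_def lexordp_lead_pos path_to_nth[OF p i(1)])
qed

lemma tree_op_closed:
  assumes u: "u \<in> tree_carrier T r" and v: "v \<in> tree_carrier T r"
  shows "tree_op T r u v \<in> tree_carrier T r"
  unfolding tree_carrier_iff
proof (intro conjI allI impI)
  show "tree_op T r u v \<in> pverts T \<rightarrow>\<^sub>E UNIV" by (auto simp: tree_op_def)
  have "{\<alpha> \<in> pverts T. tree_op T r u v \<alpha> \<noteq> 0} \<subseteq>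
      {\<alpha> \<in> pverts T. u \<alpha> \<noteq> 0} \<union> {\<alpha> \<in> pverts T. v \<alpha> \<noteq> 0}"
    by (auto simp: tree_op_def)
  then show "finite {\<alpha> \<in> pverts T. tree_op T r u v \<alpha> \<noteq> 0}"
    using u v by (auto simp: tree_carrier_iff intro: finite_subset)
  fix p assume p: "root_path T r p"
  show "\<not> lead_pos p (\<lambda>a. - tree_op T r u v a)"
  proof (cases "lead_pos p (\<lambda>a. u a - v a)")
    case True
    then show ?thesis using lead_pos_asym[OF True] tree_op_path[OF p]
        lead_pos_cong[of p "\<lambda>a. - tree_op T r u v a" "\<lambda>a. - (u a - v a)"] by simp
  next
    case False
    then show ?thesis using tree_op_path[OF p] by (intro lead_pos_zero) simp
  qed
qed

lemma tree_op_path2_right: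
  assumes p: "root_path T r p" and a: "a \<in> set p" and z: "z \<in> tree_carrier T r"
  shows "tree_op T r (tree_op T r x y) z a =
    (if lead_pos p (\<lambda>a. x a - y a) \<and> lead_pos p (\<lambda>a. x a - y a - z a)
     then x a - y a - z a else 0)"
proof (cases "lead_pos p (\<lambda>a. x a - y a)")
  case True
  then show ?thesis using tree_op_path[OF p] a
      lead_pos_cong[of p "\<lambda>a. tree_op T r x y a - z a" "\<lambda>a. x a - y a - z a"] by simp
next
  case False
  have "\<not> lead_pos p (\<lambda>a. tree_op T r x y a - z a)"
    using tree_op_path[OF p] z p False
      lead_pos_cong[of p "\<lambda>a. tree_op T r x y a - z a" "\<lambda>a. - z a"] by (auto simp: tree_carrier_iff)
  then show ?thesis using tree_op_path[OF p a] False by simp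
qed

lemma tree_op_path2_left:
  assumes p: "root_path T r p" and a: "a \<in> set p"
    and x: "x \<in> tree_carrier T r" and y: "y \<in> tree_carrier T r"
  shows "tree_op T r x (tree_op T r x y) a = (if lead_pos p (\<lambda>a. x a - y a) then y a else x a)"
proof (cases "lead_pos p (\<lambda>a. x a - y a)")
  case True
  then have "lead_pos p (\<lambda>a. x a - tree_op T r x y a) \<longleftrightarrow> lead_pos p y"
    using tree_op_path[OF p] by (intro lead_pos_cong) simp
  moreover have "\<not> lead_pos p y \<Longrightarrow> y a = 0"
    using lead_pos_cases y p a by (metis tree_carrier_iff)
  ultimately show ?thesis using tree_op_path[OF p a] True by auto
next
  case False
  then have "lead_pos p (\<lambda>a. x a - tree_op T r x y a) \<longleftrightarrow> lead_pos p x"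
    using tree_op_path[OF p] by (intro lead_pos_cong) simp
  moreover have "\<not> lead_pos p x \<Longrightarrow> x a = 0"
    using lead_pos_cases x p a by (metis tree_carrier_iff)
  ultimately show ?thesis using tree_op_path[OF p a] False by auto
qed

lemma tree_ext:
  assumes "f \<in> pverts T \<rightarrow>\<^sub>E (UNIV :: int set)" "g \<in> pverts T \<rightarrow>\<^sub>E UNIV"
    and "\<And>p a. root_path T r p \<Longrightarrow> a \<in> set p \<Longrightarrow> f a = g a"
  shows "f = g"
proof (rule PiE_ext[OF assms(1,2)])
  fix a assume "a \<in> pverts T"
  note P = path_to[OF this]
  have "path_to T r a \<noteq> []" using P(1) by (auto simp: root_path_iff vwalk_def)
  then show "f a = g a" using assms(3)[OF P(1)] P(2) last_in_set by metis
qed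

theorem comm_bck_algebra_tree_algebra: "comm_bck_algebra (tree_algebra T r)"
proof (unfold_locales, unfold tree_algebra_def bck.simps partial_object.simps)
  fix x y z assume x: "x \<in> tree_carrier T r"
  show "tree_op T r x x = (\<lambda>\<alpha> \<in> pverts T. 0)"
    by (auto simp: tree_op_def lexordp_lead_pos)
  have "x \<in> pverts T \<rightarrow>\<^sub>E UNIV" using x by (simp add: tree_carrier_iff)
  then show "tree_op T r x (\<lambda>\<alpha> \<in> pverts T. 0) = x"
  proof (rule tree_ext[rotated])
    fix p a assume p: "root_path T r p" and a: "a \<in> set p"
    have V: "b \<in> pverts T" if "b \<in> set p" for b
      using p that by (auto simp: root_path_iff vwalk_def)
    have "lead_pos p (\<lambda>a. x a - (\<lambda>\<alpha> \<in> pverts T. 0) a) \<longleftrightarrow> lead_pos p x"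
      using V by (intro lead_pos_cong) simp
    moreover have "\<not> lead_pos p x \<Longrightarrow> x a = 0"
      using lead_pos_cases x p a by (metis tree_carrier_iff)
    ultimately show "tree_op T r x (\<lambda>\<alpha> \<in> pverts T. 0) a = x a"
      using tree_op_path[OF p a] V[OF a] by auto
  qed (auto simp: tree_op_def)
  assume y: "y \<in> tree_carrier T r"
  show "tree_op T r x y \<in> tree_carrier T r" using x y by (rule tree_op_closed)
  show "tree_op T r x (tree_op T r x y) = tree_op T r y (tree_op T r y x)"
  proof (rule tree_ext)
    fix p a assume p: "root_path T r p" and a: "a \<in> set p"
    show "tree_op T r x (tree_op T r x y) a = tree_op T r y (tree_op T r y x) a"
      using tree_op_path2_left[OF p a x y] tree_op_path2_left[OF p a y x]
        lead_pos_asym[of p "\<lambda>a. x a - y a"] lead_pos_cases[OF _ _ a, of "\<lambda>a. x a - y a"] by auto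
  qed (auto simp: tree_op_def)
  assume z: "z \<in> tree_carrier T r"
  show "tree_op T r (tree_op T r x y) z = tree_op T r (tree_op T r x z) y"
  proof (rule tree_ext)
    fix p a assume p: "root_path T r p" and a: "a \<in> set p"
    have "lead_pos p (\<lambda>a. x a - y a) \<and> lead_pos p (\<lambda>a. x a - z a)"
      if "lead_pos p (\<lambda>a. x a - y a - z a)"
      using lead_pos_add_nonneg[OF that, of y] lead_pos_add_nonneg[OF that, of z] y z p
      by (simp add: tree_carrier_iff)
    moreover have "(\<lambda>a. x a - z a - y a) = (\<lambda>a. x a - y a - z a)" by auto
    ultimately show "tree_op T r (tree_op T r x y) z a = tree_op T r (tree_op T r x z) y a"
      using tree_op_path2_right[OF p a z, of x y] tree_op_path2_right[OF p a y, of x z] by auto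
  qed (auto simp: tree_op_def)
next
  show "(\<lambda>\<alpha> \<in> pverts T. 0) \<in> tree_carrier T r"
    by (auto simp: tree_carrier_def)
       (metis less_irrefl root_path_verts)
qed

end

end

theory Submission
  imports Defs
begin

text \<open>
  An element of the algebra of the star with leaves \<open>1, \<dots>, n\<close> is an integer vector indexed by
  \<open>{0..n}\<close> that either has a positive root value and arbitrary leaf values, or vanishes at the root
  and is non-negative at every leaf.  The first kind dominates the second, in the sense that the
  operation gives zero as soon as the left root value is smaller than the right one.  On the second
  kind the operation is truncated subtraction, separately at each leaf.

  If an ideal has an element \<open>u\<close> that is positive at the root, then subtracting \<open>u\<close> repeatedly from
  any \<open>v\<close> makes the root value of \<open>v\<close> smaller than that of \<open>u\<close>, and one more subtraction gives zero.
  Such an ideal is therefore the whole algebra.  Otherwise all its elements vanish at the root, and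
  it consists of all elements that are supported on the set \<open>S\<close> of leaves at which some member of the
  ideal is non-zero: a vector supported on \<open>S\<close> that is positive at \<open>j \<in> S\<close> is lowered by subtracting
  a member of the ideal that is positive at \<open>j\<close>, so it reaches zero after finitely many steps.
  Both arguments are a descent inside a set of elements (\<open>ideal_contains_by_descent\<close>).

  The proper ideals are thus indexed, monotonically and faithfully, by the sets of leaves, and the
  whole algebra is added on top.  An order isomorphism transports joins and meets
  (\<open>lattice_isomorphic_if_order_isomorphic\<close>).
\<close>

section \<open>Order isomorphisms of lattices\<close>

lemma lattice_of_closed_subset:
  fixes C :: "'a :: lattice set"
  assumes sup: "\<And>x y. x \<in> C \<Longrightarrow> y \<in> C \<Longrightarrow> Lattices.sup x y \<in> C"
    and inf: "\<And>x y. x \<in> C \<Longrightarrow> y \<in> C \<Longrightarrow> Lattices.inf x y \<in> C"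
  shows "lattice \<lparr>carrier = C, eq = (=), le = (\<le>)\<rparr>"
proof -
  let ?L = "\<lparr>carrier = C, eq = (=), le = (\<le>)\<rparr>"
  interpret partial_order ?L by unfold_locales auto
  show ?thesis
  proof unfold_locales
    fix x y assume "x \<in> carrier ?L" "y \<in> carrier ?L"
    then have "least ?L (Lattices.sup x y) (Upper ?L {x, y})"
      "greatest ?L (Lattices.inf x y) (Lower ?L {x, y})"
      using sup inf by (auto simp: least_def greatest_def Upper_def Lower_def)
    then show "\<exists>s. least ?L s (Upper ?L {x, y})" "\<exists>s. greatest ?L s (Lower ?L {x, y})" by auto
  qed
qed

text \<open>
  The map \<open>f\<close> takes the upper bounds of a pair onto the upper bounds of the image pair, and likewise
  for lower bounds.  Hence \<open>M\<close> inherits binary suprema and infima from \<open>L\<close>, so that joins of ideals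
  never have to be computed.
\<close>

lemma lattice_isomorphic_if_order_isomorphic:
  assumes L: "lattice L" and M_eq: "eq M = (=)"
    and bij: "bij_betw f (carrier M) (carrier L)"
    and le: "\<And>x y. x \<in> carrier M \<Longrightarrow> y \<in> carrier M \<Longrightarrow> x \<sqsubseteq>\<^bsub>M\<^esub> y \<longleftrightarrow> f x \<sqsubseteq>\<^bsub>L\<^esub> f y"
  shows "lattice_isomorphic M L"
proof -
  interpret L: lattice L by (rule L)
  have fin: "x \<in> carrier M \<Longrightarrow> f x \<in> carrier L" for x using bij by (auto simp: bij_betw_def)
  have carrier_eq: "carrier L = f ` carrier M" using bij by (simp add: bij_betw_def)
  have inj: "inj_on f (carrier M)" using bij by (simp add: bij_betw_def)
  interpret M: partial_order M
  proof unfold_locales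
    fix x y assume "x \<sqsubseteq>\<^bsub>M\<^esub> y" "y \<sqsubseteq>\<^bsub>M\<^esub> x" and xy: "x \<in> carrier M" "y \<in> carrier M"
    then have "f x = f y" using le fin L.le_antisym by metis
    then show "x .=\<^bsub>M\<^esub> y" using inj xy M_eq by (auto simp: inj_on_def)
  next
    fix x y z assume "x \<sqsubseteq>\<^bsub>M\<^esub> y" "y \<sqsubseteq>\<^bsub>M\<^esub> z" "x \<in> carrier M" "y \<in> carrier M" "z \<in> carrier M"
    then show "x \<sqsubseteq>\<^bsub>M\<^esub> z" using le fin L.le_trans by metis
  qed (use M_eq le fin L.le_refl in auto)
  have Upper_image: "Upper L {f x, f y} = f ` Upper M {x, y}"
    if "x \<in> carrier M" "y \<in> carrier M" for x y
    using that le by (auto simp: Upper_def carrier_eq)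
  have Lower_image: "Lower L {f x, f y} = f ` Lower M {x, y}"
    if "x \<in> carrier M" "y \<in> carrier M" for x y
    using that le by (auto simp: Lower_def carrier_eq)
  have least_iff: "least M s (Upper M {x, y}) \<longleftrightarrow> least L (f s) (Upper L {f x, f y})"
    if xy: "x \<in> carrier M" "y \<in> carrier M" and s: "s \<in> carrier M" for x y s
  proof -
    have "f s \<in> f ` Upper M {x, y} \<longleftrightarrow> s \<in> Upper M {x, y}"
      using inj s by (rule inj_on_image_mem_iff) simp
    moreover have "s \<sqsubseteq>\<^bsub>M\<^esub> u \<longleftrightarrow> f s \<sqsubseteq>\<^bsub>L\<^esub> f u" if "u \<in> Upper M {x, y}" for u
      using le s that by (simp add: Upper_def)
    ultimately show ?thesis
      using fin by (auto simp: least_def Upper_image[OF xy] dest: subsetD[OF Upper_closed])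
  qed
  have greatest_iff: "greatest M s (Lower M {x, y}) \<longleftrightarrow> greatest L (f s) (Lower L {f x, f y})"
    if xy: "x \<in> carrier M" "y \<in> carrier M" and s: "s \<in> carrier M" for x y s
  proof -
    have "f s \<in> f ` Lower M {x, y} \<longleftrightarrow> s \<in> Lower M {x, y}"
      using inj s by (rule inj_on_image_mem_iff) simp
    moreover have "u \<sqsubseteq>\<^bsub>M\<^esub> s \<longleftrightarrow> f u \<sqsubseteq>\<^bsub>L\<^esub> f s" if "u \<in> Lower M {x, y}" for u
      using le s that by (simp add: Lower_def)
    ultimately show ?thesis
      using fin by (auto simp: greatest_def Lower_image[OF xy] dest: subsetD[OF Lower_closed])
  qed
  have "lattice M"
  proof unfold_locales
    fix x y assume xy: "x \<in> carrier M" "y \<in> carrier M"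
    obtain s where "least L s (Upper L {f x, f y})"
      using L.sup_of_two_exists fin xy by blast
    moreover from this have "s \<in> f ` carrier M"
      unfolding carrier_eq[symmetric] by (simp add: least_def Upper_def)
    ultimately show "\<exists>s. least M s (Upper M {x, y})" using least_iff xy by blast
    obtain s where "greatest L s (Lower L {f x, f y})"
      using L.inf_of_two_exists fin xy by blast
    moreover from this have "s \<in> f ` carrier M"
      unfolding carrier_eq[symmetric] by (simp add: greatest_def Lower_def)
    ultimately show "\<exists>s. greatest M s (Lower M {x, y})" using greatest_iff xy by blast
  qed
  then interpret M: lattice M .
  have join: "f (x \<squnion>\<^bsub>M\<^esub> y) = f x \<squnion>\<^bsub>L\<^esub> f y" if xy: "x \<in> carrier M" "y \<in> carrier M" for x y
  proof -
    have "least M (x \<squnion>\<^bsub>M\<^esub> y) (Upper M {x, y})"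
      using xy M.joinI[where P = "\<lambda>s. least M s (Upper M {x, y})"] by auto
    then have "least L (f (x \<squnion>\<^bsub>M\<^esub> y)) (Upper L {f x, f y})"
      using least_iff xy by simp
    moreover have "least L (f x \<squnion>\<^bsub>L\<^esub> f y) (Upper L {f x, f y})"
      using xy fin L.joinI[where P = "\<lambda>s. least L s (Upper L {f x, f y})"] by auto
    ultimately show ?thesis by (rule L.least_unique)
  qed
  have meet: "f (x \<sqinter>\<^bsub>M\<^esub> y) = f x \<sqinter>\<^bsub>L\<^esub> f y" if xy: "x \<in> carrier M" "y \<in> carrier M" for x y
  proof -
    have "greatest M (x \<sqinter>\<^bsub>M\<^esub> y) (Lower M {x, y})"
      using xy M.meetI[where P = "\<lambda>s. greatest M s (Lower M {x, y})"] by auto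
    then have "greatest L (f (x \<sqinter>\<^bsub>M\<^esub> y)) (Lower L {f x, f y})"
      using greatest_iff xy by simp
    moreover have "greatest L (f x \<sqinter>\<^bsub>L\<^esub> f y) (Lower L {f x, f y})"
      using xy fin L.meetI[where P = "\<lambda>s. greatest L s (Lower L {f x, f y})"] by auto
    ultimately show ?thesis by (rule L.greatest_unique)
  qed
  show ?thesis unfolding lattice_isomorphic_def join_pres_def meet_pres_def
    using bij L \<open>lattice M\<close> join meet by blast
qed


section \<open>The algebra of a star\<close>

lemma star_tree_root_path:
  "root_path (star_tree n) 0 p \<longleftrightarrow> p = [0] \<or> (\<exists>i \<in> {1..n}. p = [0, i])"
proof
  interpret rooted_tree "star_tree n" 0 by (rule rooted_tree_star_tree)
  assume "root_path (star_tree n) 0 p"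
  then have p: "vwalk p (with_proj (star_tree n))" "hd p = 0" by (auto simp: root_path_iff)
  then have "last p \<in> {0..n}" by (auto simp: vwalk_def star_tree_def subset_iff)
  then show "p = [0] \<or> (\<exists>i \<in> {1..n}. p = [0, i])"
    using star_tree_vwalk[OF p] by (auto split: if_splits)
qed (auto simp: root_path_def vpath_def vwalk_def star_tree_def)

lemma lead_pos_root: "lead_pos [a] w \<longleftrightarrow> w a > 0"
  by (auto simp: lead_pos_def)

lemma lead_pos_edge: "lead_pos [a, b] w \<longleftrightarrow> w a > 0 \<or> w a = 0 \<and> w b > 0"
  by (auto simp: lead_pos_def Ex_less_Suc2 All_less_Suc2)

lemma star_carrier_iff:
  "u \<in> carrier (tree_algebra (star_tree n) 0) \<longleftrightarrow>
    u \<in> {0..n} \<rightarrow>\<^sub>E UNIV \<and> (u 0 > 0 \<or> u 0 = 0 \<and> (\<forall>i \<in> {1..n}. u i \<ge> 0))"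
proof -
  have "pverts (star_tree n) = {0..n}" by (simp add: star_tree_def)
  then show ?thesis
    by (auto simp: tree_algebra_def tree_carrier_iff star_tree_root_path lead_pos_root
        lead_pos_edge all_conj_distrib imp_conjR dest: spec[of _ "[0]"])
qed

lemma star_op_root:
  "(u \<cdot>\<^bsub>tree_algebra (star_tree n) 0\<^esub> v) 0 = max (u 0 - v 0) 0"
proof -
  interpret rooted_tree "star_tree n" 0 by (rule rooted_tree_star_tree)
  show ?thesis
    using tree_op_path[of "[0]" 0 u v]
    by (simp add: tree_algebra_def star_tree_root_path lead_pos_root max_def)
qed

lemma star_op_leaf:
  assumes "i \<in> {1..n}"
  shows "(u \<cdot>\<^bsub>tree_algebra (star_tree n) 0\<^esub> v) i =
    (if u 0 > v 0 \<or> u 0 = v 0 \<and> u i > v i then u i - v i else 0)"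
proof -
  interpret rooted_tree "star_tree n" 0 by (rule rooted_tree_star_tree)
  show ?thesis
    using tree_op_path[of "[0, i]" i u v] assms
    by (simp add: tree_algebra_def star_tree_root_path lead_pos_edge)
qed

lemma star_zero: "\<zero>\<^bsub>tree_algebra (star_tree n) 0\<^esub> = (\<lambda>i \<in> {0..n}. 0)"
  by (simp add: tree_algebra_def star_tree_def)

text \<open>
  When \<open>S\<close> consists of leaves, the members vanish at the root and are therefore non-negative at the
  leaves: this is a copy of the functions from \<open>S\<close> to the natural numbers.
\<close>

definition supported_on :: "nat \<Rightarrow> nat set \<Rightarrow> (nat \<Rightarrow> int) set" where
  "supported_on n S = {u \<in> carrier (tree_algebra (star_tree n) 0). \<forall>i \<in> {0..n} - S. u i = 0}"

lemma indicator_in_supported_on_iff: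
  assumes "j \<le> n"
  shows "(\<lambda>i \<in> {0..n}. if i = j then 1 else 0) \<in> supported_on n S \<longleftrightarrow> j \<in> S"
  using assms by (auto simp: supported_on_def star_carrier_iff intro!: gr0I)

text \<open>Unit vectors at the leaves tell the ideals apart.\<close>

lemma supported_on_subset_iff:
  assumes "S \<subseteq> {1..n}"
  shows "supported_on n S \<subseteq> supported_on n S' \<longleftrightarrow> S \<subseteq> S'"
proof
  assume sub: "supported_on n S \<subseteq> supported_on n S'"
  show "S \<subseteq> S'"
  proof
    fix j assume "j \<in> S"
    moreover from this have "j \<le> n" using assms by auto
    ultimately show "j \<in> S'" using sub indicator_in_supported_on_iff by blast
  qed
qed (auto simp: supported_on_def)

lemma carrier_not_subset_supported_on:
  assumes "S \<subseteq> {1..n}"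
  shows "\<not> carrier (tree_algebra (star_tree n) 0) \<subseteq> supported_on n S"
proof
  let ?e = "\<lambda>i \<in> {0..n}. if i = 0 then 1 else (0 :: int)"
  assume "carrier (tree_algebra (star_tree n) 0) \<subseteq> supported_on n S"
  moreover have "?e \<in> carrier (tree_algebra (star_tree n) 0)" by (auto simp: star_carrier_iff)
  ultimately have "0 \<in> S" using indicator_in_supported_on_iff[of 0 n S] by auto
  then show False using assms by auto
qed


section \<open>The ideals\<close>

lemma bck_ideal_carrier:
  assumes "comm_bck_algebra A"
  shows "bck_ideal A (carrier A)"
  using comm_bck_algebra.zero_closed[OF assms] by (simp add: bck_ideal_def)

text \<open>
  If \<open>y\<close> is zero at a node outside \<open>S\<close>, then at that node \<open>x \<cdot> y\<close> agrees with \<open>x\<close>.  At the leaves this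
  relies on the root values of \<open>x\<close> and \<open>y\<close> being zero, so the root comes first.
\<close>

lemma bck_ideal_supported_on:
  assumes "S \<subseteq> {1..n}"
  shows "bck_ideal (tree_algebra (star_tree n) 0) (supported_on n S)"
  unfolding bck_ideal_def
proof (intro conjI ballI impI)
  let ?A = "tree_algebra (star_tree n) 0"
  show "supported_on n S \<subseteq> carrier ?A" by (auto simp: supported_on_def)
  show "\<zero>\<^bsub>?A\<^esub> \<in> supported_on n S"
    by (auto simp: supported_on_def star_carrier_iff star_zero)
  fix x y assume x: "x \<in> carrier ?A" and y: "y \<in> carrier ?A"
    and "x \<cdot>\<^bsub>?A\<^esub> y \<in> supported_on n S \<and> y \<in> supported_on n S"
  then have xy: "\<And>i. i \<in> {0..n} - S \<Longrightarrow> (x \<cdot>\<^bsub>?A\<^esub> y) i = 0 \<and> y i = 0"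
    by (auto simp: supported_on_def)
  have "0 \<in> {0..n} - S" using assms by auto
  then have x0: "x 0 = 0" and y0: "y 0 = 0"
    using xy[of 0] x by (auto simp: star_op_root star_carrier_iff)
  have "x i = 0" if "i \<in> {1..n} - S" for i
  proof -
    have "i \<in> {1..n}" "(x \<cdot>\<^bsub>?A\<^esub> y) i = 0" "y i = 0" using that xy[of i] by auto
    moreover from this have "x i \<ge> 0" using x x0 by (auto simp: star_carrier_iff)
    ultimately show ?thesis using x0 y0 by (auto simp: star_op_leaf split: if_splits)
  qed
  then have "x i = 0" if "i \<in> {0..n} - S" for i
    using that x0 by (cases "i = 0") auto
  then show "x \<in> supported_on n S" using x by (auto simp: supported_on_def)
qed

text \<open>
  A minimal counterexample \<open>x\<close> would be lowered to some \<open>x \<cdot> y\<close> in \<open>I\<close> with \<open>y \<in> I\<close>, which puts \<open>x\<close>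
  into \<open>I\<close>.
\<close>

lemma ideal_contains_by_descent:
  fixes m :: "'a \<Rightarrow> nat"
  assumes I: "bck_ideal A I" and P: "P \<subseteq> carrier A"
    and lower: "\<And>x. x \<in> P \<Longrightarrow> x \<notin> I \<Longrightarrow> \<exists>y \<in> I. x \<cdot>\<^bsub>A\<^esub> y \<in> P \<and> m (x \<cdot>\<^bsub>A\<^esub> y) < m x"
  shows "P \<subseteq> I"
proof
  fix x assume "x \<in> P"
  then show "x \<in> I"
  proof (induction x rule: measure_induct_rule[of m])
    case (less x)
    show ?case
    proof (rule ccontr)
      assume "x \<notin> I"
      then obtain y where "y \<in> I" "x \<cdot>\<^bsub>A\<^esub> y \<in> I" using lower less by blast
      then show False using I P less.prems \<open>x \<notin> I\<close> unfolding bck_ideal_def by blast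
    qed
  qed
qed

text \<open>
  The root value is a descent measure: as long as it is at least \<open>u 0\<close>, subtracting \<open>u\<close> decreases it
  by \<open>u 0\<close>.
\<close>

lemma ideal_eq_carrier_if_root_pos:
  assumes I: "bck_ideal (tree_algebra (star_tree n) 0) I" and u: "u \<in> I" "u 0 > 0"
  shows "I = carrier (tree_algebra (star_tree n) 0)"
proof
  let ?A = "tree_algebra (star_tree n) 0"
  interpret rooted_tree "star_tree n" 0 by (rule rooted_tree_star_tree)
  interpret comm_bck_algebra ?A by (rule comm_bck_algebra_tree_algebra)
  show sub: "I \<subseteq> carrier ?A" using I by (auto simp: bck_ideal_def)
  show "carrier ?A \<subseteq> I"
  proof (rule ideal_contains_by_descent[OF I, where m = "\<lambda>v. nat (v 0)"])
    fix v assume v: "v \<in> carrier ?A" and "v \<notin> I"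
    have vu: "v \<cdot>\<^bsub>?A\<^esub> u \<in> carrier ?A" using v u sub op_closed by blast
    \<comment> \<open>Otherwise \<open>u\<close> dominates \<open>v\<close>, so \<open>v \<cdot> u\<close> is zero and \<open>v\<close> lies in the ideal.\<close>
    have "u 0 \<le> v 0"
    proof (rule ccontr)
      assume less: "\<not> u 0 \<le> v 0"
      then have "(v \<cdot>\<^bsub>?A\<^esub> u) i = 0" if "i \<in> {0..n}" for i
        using that star_op_root[of n v u] star_op_leaf[of i n v u] by (cases "i = 0") auto
      then have "v \<cdot>\<^bsub>?A\<^esub> u = \<zero>\<^bsub>?A\<^esub>"
        using vu zero_closed unfolding star_carrier_iff star_zero by (intro PiE_ext) auto
      then have "v \<in> I" using I u v sub unfolding bck_ideal_def by (metis subsetD)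
      with \<open>v \<notin> I\<close> show False ..
    qed
    then have "nat ((v \<cdot>\<^bsub>?A\<^esub> u) 0) < nat (v 0)" using u by (simp add: star_op_root)
    with vu u show "\<exists>y \<in> I. v \<cdot>\<^bsub>?A\<^esub> y \<in> carrier ?A \<and> nat ((v \<cdot>\<^bsub>?A\<^esub> y) 0) < nat (v 0)" by blast
  qed simp
qed

text \<open>
  Here the descent measure is the sum of the leaf values, and the member of \<open>I\<close> to subtract depends on
  the leaf at which \<open>v\<close> is still positive.
\<close>

lemma ideal_eq_supported_on_if_root_zero:
  assumes I: "bck_ideal (tree_algebra (star_tree n) 0) I" and root: "\<And>u. u \<in> I \<Longrightarrow> u 0 = 0"
  shows "I = supported_on n {i \<in> {1..n}. \<exists>u \<in> I. u i \<noteq> 0}"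
proof
  let ?A = "tree_algebra (star_tree n) 0"
  define S where "S = {i \<in> {1..n}. \<exists>u \<in> I. u i \<noteq> 0}"
  interpret rooted_tree "star_tree n" 0 by (rule rooted_tree_star_tree)
  interpret comm_bck_algebra ?A by (rule comm_bck_algebra_tree_algebra)
  have sub: "I \<subseteq> carrier ?A" using I by (auto simp: bck_ideal_def)
  have "supported_on n S \<subseteq> I"
  proof (rule ideal_contains_by_descent[OF I, where m = "\<lambda>v. \<Sum>i \<in> {1..n}. nat (v i)"])
    show "supported_on n S \<subseteq> carrier ?A" by (auto simp: supported_on_def)
    fix v assume v: "v \<in> supported_on n S" and "v \<notin> I"
    have vA: "v \<in> carrier ?A" and vS: "\<And>i. i \<in> {0..n} - S \<Longrightarrow> v i = 0"
      using v by (auto simp: supported_on_def)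
    have v0: "v 0 = 0" using vS[of 0] by (auto simp: S_def)
    have v_nonneg: "v i \<ge> 0" if "i \<in> {1..n}" for i
      using vA v0 that by (auto simp: star_carrier_iff)
    have "\<exists>j \<in> S. v j \<noteq> 0"
    proof (rule ccontr)
      assume "\<not> (\<exists>j \<in> S. v j \<noteq> 0)"
      then have "v i = 0" if "i \<in> {0..n}" for i using vS that by blast
      then have "v = \<zero>\<^bsub>?A\<^esub>"
        using vA zero_closed unfolding star_carrier_iff star_zero by (intro PiE_ext) auto
      then show False using I \<open>v \<notin> I\<close> by (simp add: bck_ideal_def)
    qed
    then obtain j where j: "j \<in> S" "v j \<noteq> 0" by blast
    then obtain u where u: "u \<in> I" "u j \<noteq> 0" by (auto simp: S_def)
    have u0: "u 0 = 0" using root u by blast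
    have u_nonneg: "u i \<ge> 0" if "i \<in> {1..n}" for i
      using u sub u0 that by (fastforce simp: star_carrier_iff)
    have jn: "j \<in> {1..n}" using j by (simp add: S_def)
    have vu: "(v \<cdot>\<^bsub>?A\<^esub> u) i = max (v i - u i) 0" if "i \<in> {1..n}" for i
      using star_op_leaf[OF that] u0 v0 by simp
    have "v \<cdot>\<^bsub>?A\<^esub> u \<in> supported_on n S"
      unfolding supported_on_def
    proof (intro CollectI conjI ballI)
      show "v \<cdot>\<^bsub>?A\<^esub> u \<in> carrier ?A" using vA u sub op_closed by blast
      fix i assume i: "i \<in> {0..n} - S"
      show "(v \<cdot>\<^bsub>?A\<^esub> u) i = 0"
      proof (cases "i = 0")
        case True
        then show ?thesis by (simp add: star_op_root v0 u0)
      next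
        case False
        then have "i \<in> {1..n}" using i by auto
        then show ?thesis using vu u_nonneg[of i] vS[OF i] by simp
      qed
    qed
    moreover have "(\<Sum>i \<in> {1..n}. nat ((v \<cdot>\<^bsub>?A\<^esub> u) i)) < (\<Sum>i \<in> {1..n}. nat (v i))"
    proof (rule sum_strict_mono_ex1)
      show "\<forall>i \<in> {1..n}. nat ((v \<cdot>\<^bsub>?A\<^esub> u) i) \<le> nat (v i)"
        using vu u_nonneg v_nonneg by (force simp: max_def)
      show "\<exists>i \<in> {1..n}. nat ((v \<cdot>\<^bsub>?A\<^esub> u) i) < nat (v i)"
        using jn vu[OF jn] u_nonneg[OF jn] v_nonneg[OF jn] j u by (intro bexI[of _ j]) auto
    qed simp
    ultimately show "\<exists>y \<in> I. v \<cdot>\<^bsub>?A\<^esub> y \<in> supported_on n S \<and>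
        (\<Sum>i \<in> {1..n}. nat ((v \<cdot>\<^bsub>?A\<^esub> y) i)) < (\<Sum>i \<in> {1..n}. nat (v i))"
      using u by blast
  qed
  then show "supported_on n {i \<in> {1..n}. \<exists>u \<in> I. u i \<noteq> 0} \<subseteq> I" by (simp add: S_def)
  show "I \<subseteq> supported_on n {i \<in> {1..n}. \<exists>u \<in> I. u i \<noteq> 0}"
  proof
    fix u assume u: "u \<in> I"
    have "u i = 0" if "i \<in> {0..n} - {i \<in> {1..n}. \<exists>u \<in> I. u i \<noteq> 0}" for i
      using that u root[OF u] by (cases "i = 0") auto
    then show "u \<in> supported_on n {i \<in> {1..n}. \<exists>u \<in> I. u i \<noteq> 0}"
      using u sub by (auto simp: supported_on_def)
  qed
qed

lemma star_ideal_iff: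
  "bck_ideal (tree_algebra (star_tree n) 0) I \<longleftrightarrow>
    I = carrier (tree_algebra (star_tree n) 0) \<or> (\<exists>S \<subseteq> {1..n}. I = supported_on n S)"
    (is "?ideal \<longleftrightarrow> ?whole \<or> ?supp")
proof
  assume I: ?ideal
  show "?whole \<or> ?supp"
  proof (cases "\<exists>u \<in> I. u 0 > 0")
    case True
    then show ?thesis using ideal_eq_carrier_if_root_pos[OF I] by blast
  next
    case False
    then have "u 0 = 0" if "u \<in> I" for u
      using I that by (fastforce simp: bck_ideal_def star_carrier_iff)
    then have "I = supported_on n {i \<in> {1..n}. \<exists>u \<in> I. u i \<noteq> 0}"
      by (rule ideal_eq_supported_on_if_root_zero[OF I])
    moreover have "{i \<in> {1..n}. \<exists>u \<in> I. u i \<noteq> 0} \<subseteq> {1..n}" by blast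
    ultimately show ?thesis by blast
  qed
next
  assume "?whole \<or> ?supp"
  then show ?ideal
    using bck_ideal_carrier[OF rooted_tree.comm_bck_algebra_tree_algebra[OF rooted_tree_star_tree]]
      bck_ideal_supported_on by blast
qed


section \<open>The lattice of ideals\<close>

definition star_ideal :: "nat \<Rightarrow> nat set top \<Rightarrow> (nat \<Rightarrow> int) set" where
  "star_ideal n s = (case s of top.Value S \<Rightarrow> supported_on n S
     | top.Top \<Rightarrow> carrier (tree_algebra (star_tree n) 0))"

lemma star_ideal_subset_iff:
  assumes "s \<in> carrier (boolean_lattice_with_top n)" "t \<in> carrier (boolean_lattice_with_top n)"
  shows "star_ideal n s \<subseteq> star_ideal n t \<longleftrightarrow> s \<le> t"
proof (cases t)
  case t: (Value S')
  show ?thesis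
  proof (cases s)
    case (Value S)
    then show ?thesis using assms t supported_on_subset_iff[of S n S']
      by (auto simp: star_ideal_def boolean_lattice_with_top_def)
  next
    case Top
    then show ?thesis using assms t carrier_not_subset_supported_on[of S' n]
      by (auto simp: star_ideal_def boolean_lattice_with_top_def)
  qed
next
  case Top
  then show ?thesis by (auto simp: star_ideal_def supported_on_def split: top.splits)
qed

lemma bij_betw_star_ideal:
  "bij_betw (star_ideal n) (carrier (boolean_lattice_with_top n))
     (carrier (ideal_lattice (tree_algebra (star_tree n) 0)))"
  unfolding bij_betw_def
proof
  show "inj_on (star_ideal n) (carrier (boolean_lattice_with_top n))"
    using star_ideal_subset_iff by (intro inj_onI antisym) blast+
  show "star_ideal n ` carrier (boolean_lattice_with_top n) =
      carrier (ideal_lattice (tree_algebra (star_tree n) 0))"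
    by (auto simp: ideal_lattice_def star_ideal_iff boolean_lattice_with_top_def star_ideal_def
        image_image)
qed

lemma lattice_boolean_lattice_with_top: "lattice (boolean_lattice_with_top n)"
  unfolding boolean_lattice_with_top_def
  by (rule lattice_of_closed_subset) (auto simp: sup_top_def inf_top_def)

theorem theorem3p19:
  fixes n :: nat
  assumes "n \<ge> 1"
  shows "lattice_isomorphic (ideal_lattice (tree_algebra (star_tree n) 0))
           (boolean_lattice_with_top n)"
proof (rule lattice_isomorphic_if_order_isomorphic[OF lattice_boolean_lattice_with_top])
  let ?M = "ideal_lattice (tree_algebra (star_tree n) 0)"
  let ?B = "boolean_lattice_with_top n"
  let ?f = "inv_into (carrier ?B) (star_ideal n)"
  show "eq ?M = (=)" by (simp add: ideal_lattice_def)
  show f: "bij_betw ?f (carrier ?M) (carrier ?B)"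
    by (rule bij_betw_inv_into[OF bij_betw_star_ideal])
  fix I J assume IJ: "I \<in> carrier ?M" "J \<in> carrier ?M"
  then have "star_ideal n (?f I) = I" "star_ideal n (?f J) = J"
    using bij_betw_inv_into_right[OF bij_betw_star_ideal] by blast+
  moreover have "?f I \<in> carrier ?B" "?f J \<in> carrier ?B"
    using f IJ by (auto simp: bij_betw_def)
  ultimately have "I \<subseteq> J \<longleftrightarrow> ?f I \<le> ?f J"
    using star_ideal_subset_iff by metis
  then show "I \<sqsubseteq>\<^bsub>?M\<^esub> J \<longleftrightarrow> ?f I \<sqsubseteq>\<^bsub>?B\<^esub> ?f J"
    by (simp add: ideal_lattice_def boolean_lattice_with_top_def)
qed

end
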